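(* Let $1\le t<s$ be integers, let $\Gamma$ be a finite alphabet of size $v$, let $\phi:\Gamma^s\to\Gamma^s$ be a $(t,s,v)$-AONT, and let $\mathbf{X}$ be a random variable on $\Gamma^s$ (the input $s$-tuple) with $\Pr[\mathbf{X}=\mathbf{x}]>0$ for all $\mathbf{x}\in\Gamma^s$. If the AONT provides perfect security with respect to $\mathbf{X}$, then $\Pr[\mathbf{X}=\mathbf{x}]=1/v^s$ for all $s$-tuples $\mathbf{x}\in\Gamma^s$.
   Context: A function $\phi:\Gamma^s\to\Gamma^s$, $|\Gamma|=v$, is a $(t,s,v)$-AONT (all-or-nothing transform) if its array representation, i.e. the $v^s\times 2s$ array (columns labeled $1,\dots,2s$) having for each $\mathbf{x}\in\Gamma^s$ one row consisting of $\mathbf{x}$ followed by $\phi(\mathbf{x})$, is unbiased with respect to the column sets (1) $\{1,\dots,s\}$, (2) $\{s+1,\dots,2s\}$, and (3) $I\cup J$ for all $I\subseteq\{1,\dots,s\}$ with $|I|=t$ and all $J\subseteq\{s+1,\dots,2s\}$ with $|J|=s-t$. Here an array with $N$ rows over $\Gamma$ is unbiased with respect to a set $D$ of columns if, after deleting all columns not in $D$, every $|D|$-tuple over $\Gamma$ occurs as a row exactly $N/v^{|D|}$ times. $\mathbf{X}=(\mathbf{X}_1,\dots,\mathbf{X}_s)$ is the random input and $\mathbf{Y}=(\mathbf{Y}_1,\dots,\mathbf{Y}_s)=\phi(\mathbf{X})$ is the output. For $I,J\subseteq\{1,\dots,s\}$, $\mathbf{X}_I=(\mathbf{X}_i)_{i\in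 I}$ and $\mathbf{Y}_J=(\mathbf{Y}_j)_{j\in J}$. With $\mathsf{H}$ denoting Shannon entropy, the AONT provides perfect security with respect to $\mathbf{X}$ if $\mathsf{H}(\mathbf{X}_I\mid\mathbf{Y}_J)=\mathsf{H}(\mathbf{X}_I)$ for all $I,J\subseteq\{1,\dots,s\}$ with $|I|=t$, $|J|=s-t$; equivalently, $\Pr[\mathbf{X}_I=\mathbf{u},\mathbf{Y}_J=\mathbf{v}]=\Pr[\mathbf{X}_I=\mathbf{u}]\,\Pr[\mathbf{Y}_J=\mathbf{v}]$ for all such $I,J$ and all $\mathbf{u}\in\Gamma^t$, $\mathbf{v}\in\Gamma^{s-t}$. *)

theory Defs
  imports "HOL-Probability.Information"
begin

text \<open>
  A tuple over \<open>\<Gamma>\<close> with coordinates labelled by \<open>D\<close> is an element of the extensional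
  function space \<open>D \<rightarrow>\<^sub>E \<Gamma>\<close>; thus \<open>\<Gamma>\<^sup>s\<close> is \<open>{1..s} \<rightarrow>\<^sub>E \<Gamma>\<close>, and deleting the columns
  (coordinates) outside \<open>D\<close> is \<open>restrict _ D\<close>.  An array is a finite index set \<open>R\<close> of rows
  together with \<open>A :: 'r \<Rightarrow> nat \<Rightarrow> 'a\<close>, where \<open>A r c\<close> is the entry in row \<open>r\<close> and column \<open>c\<close>,
  so repeated rows are counted with multiplicity.
\<close>

definition unbiased :: "'a set \<Rightarrow> 'r set \<Rightarrow> ('r \<Rightarrow> nat \<Rightarrow> 'a) \<Rightarrow> nat set \<Rightarrow> bool" where
  "unbiased \<Gamma> R A D \<longleftrightarrow>
     (\<forall>u \<in> D \<rightarrow>\<^sub>E \<Gamma>. real (card {r \<in> R. restrict (A r) D = u}) = real (card R) / real (card \<Gamma>) ^ card D)"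

text \<open>Rows of the array representation are indexed by the inputs \<open>x \<in> \<Gamma>\<^sup>s\<close>.\<close>

definition array_rep :: "nat \<Rightarrow> ((nat \<Rightarrow> 'a) \<Rightarrow> (nat \<Rightarrow> 'a)) \<Rightarrow> (nat \<Rightarrow> 'a) \<Rightarrow> nat \<Rightarrow> 'a" where
  "array_rep s \<phi> x = (\<lambda>c\<in>{1..2 * s}. if c \<le> s then x c else \<phi> x (c - s))"

definition is_aont :: "nat \<Rightarrow> nat \<Rightarrow> nat \<Rightarrow> 'a set \<Rightarrow> ((nat \<Rightarrow> 'a) \<Rightarrow> (nat \<Rightarrow> 'a)) \<Rightarrow> bool" where
  "is_aont t s v \<Gamma> \<phi> \<longleftrightarrow>
     finite \<Gamma> \<and> card \<Gamma> = v \<and>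
     \<phi> \<in> ({1..s} \<rightarrow>\<^sub>E \<Gamma>) \<rightarrow> ({1..s} \<rightarrow>\<^sub>E \<Gamma>) \<and>
     unbiased \<Gamma> ({1..s} \<rightarrow>\<^sub>E \<Gamma>) (array_rep s \<phi>) {1..s} \<and>
     unbiased \<Gamma> ({1..s} \<rightarrow>\<^sub>E \<Gamma>) (array_rep s \<phi>) {s+1..2 * s} \<and>
     (\<forall>I J. I \<subseteq> {1..s} \<and> card I = t \<and> J \<subseteq> {s+1..2 * s} \<and> card J = s - t \<longrightarrow>
        unbiased \<Gamma> ({1..s} \<rightarrow>\<^sub>E \<Gamma>) (array_rep s \<phi>) (I \<union> J))"

text \<open>
  Here \<open>X\<^sub>I\<close> is \<open>\<lambda>\<omega>. restrict (X \<omega>) I\<close>, the output is \<open>Y = \<phi>(X)\<close>, and the entropies are the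
  library's Shannon entropies of discrete random variables, to the base \<open>b > 1\<close> of the locale.
\<close>

definition (in information_space) perfect_security ::
  "nat \<Rightarrow> nat \<Rightarrow> ((nat \<Rightarrow> 'c) \<Rightarrow> (nat \<Rightarrow> 'c)) \<Rightarrow> ('a \<Rightarrow> nat \<Rightarrow> 'c) \<Rightarrow> bool" where
  "perfect_security t s \<phi> X \<longleftrightarrow>
     (\<forall>I J. I \<subseteq> {1..s} \<and> J \<subseteq> {1..s} \<and> card I = t \<and> card J = s - t \<longrightarrow>
        \<H>((\<lambda>\<omega>. restrict (X \<omega>) I) | (\<lambda>\<omega>. restrict (\<phi> (X \<omega>)) J)) = \<H>(\<lambda>\<omega>. restrict (X \<omega>) I))"

end

theory Submission
  imports Defs
begin

text \<open>
  Write \<open>p(x)\<close> for the probability of \<open>X = x\<close>.  Perfect security says that \<open>X\<^sub>I\<close> and \<open>Y\<^sub>J\<close> have zero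
  mutual information, hence are independent, whenever \<open>card I = t\<close> and \<open>card J = s - t\<close>
  (\<open>indep_var_of_conditional_entropy_eq\<close>).  For an AONT, the pair \<open>(x\<^sub>I, \<phi>(x)\<^sub>J)\<close> determines \<open>x\<close>
  (\<open>aont_inputs_eq\<close>), so the event \<open>X = x\<close> is the intersection of two independent events and
  \<open>p(x) = a\<^sub>I(x\<^sub>I) * c\<^sub>J(\<phi>(x)\<^sub>J)\<close>, where \<open>a\<^sub>I\<close> and \<open>c\<^sub>J\<close> are the marginal distributions.

  The same \<open>p(x)\<close> factors in this way for every choice of \<open>I\<close> and \<open>J\<close>.  Keeping \<open>J\<close> fixed and
  cancelling \<open>c\<^sub>J\<close>, which is nonzero because \<open>p\<close> is positive, the value \<open>a\<^sub>I(x\<^sub>I)\<close> is the same for all \<open>I\<close>; since \<open>t < s\<close>, any given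
  coordinate is avoided by some \<open>I\<close>, so this value depends on no coordinate of \<open>x\<close> at all.  In the
  same way \<open>0 < t\<close> makes \<open>c\<^sub>J(y\<^sub>J)\<close> constant in \<open>y\<close>, because \<open>\<phi>\<close> is onto.  Hence \<open>p\<close> is
  constant (\<open>product_of_marginals_constant\<close>), and a constant distribution on \<open>v\<^sup>s\<close> points is uniform.
\<close>

section \<open>Independence from equality of entropies\<close>

text \<open>
  Vanishing mutual information characterises independence only in the presence of absolute
  continuity and integrability of the entropy density.  Both are automatic here, because the
  joint distribution lives on finitely many points, each of which is a measurable rectangle.
\<close>

lemma (in information_space) indep_var_of_conditional_entropy_eq:
  assumes X: "simple_function M X" and Y: "simple_function M Y"
    and eq: "\<H>(X | Y) = \<H>(X)"
  shows "indep_var (count_space (X ` space M)) X (count_space (Y ` space M)) Y"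
proof -
  let ?S = "count_space (X ` space M)" and ?T = "count_space (Y ` space M)"
  let ?P = "distr M ?S X \<Otimes>\<^sub>M distr M ?T Y"
  let ?Q = "distr M (?S \<Otimes>\<^sub>M ?T) (\<lambda>x. (X x, Y x))"
  have fin: "finite (X ` space M)" "finite (Y ` space M)"
    using X Y by (auto dest: simple_functionD(1))
  have rvX [measurable]: "X \<in> M \<rightarrow>\<^sub>M ?S" and rvY [measurable]: "Y \<in> M \<rightarrow>\<^sub>M ?T"
    using X Y by (auto simp: simple_function_eq_measurable measurable_count_space_eq2 
        intro: simple_functionD)
  have ST: "?S \<Otimes>\<^sub>M ?T = count_space (X ` space M \<times> Y ` space M)"
    using fin by (simp add: pair_measure_count_space)
  interpret DX: prob_space "distr M ?S X" by (rule prob_space_distr) simp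
  interpret DY: prob_space "distr M ?T Y" by (rule prob_space_distr) simp
  interpret Q: prob_space ?Q by (rule prob_space_distr) simp
  have setsST: "sets (?S \<Otimes>\<^sub>M ?T) = Pow (X ` space M \<times> Y ` space M)"
    by (subst ST) simp
  have spaceST: "space (?S \<Otimes>\<^sub>M ?T) = X ` space M \<times> Y ` space M"
    by (simp add: space_pair_measure)
  have setsP: "sets ?P = Pow (X ` space M \<times> Y ` space M)"
  proof -
    have "sets ?P = sets (?S \<Otimes>\<^sub>M ?T)" by (rule sets_pair_measure_cong) auto
    with setsST show ?thesis by (rule trans[rotated])
  qed
  have null_point: "{z} \<in> null_sets ?Q" if z: "{z} \<in> null_sets ?P" for z
  proof -
    obtain x y where xy: "z = (x, y)" by (cases z)
    have mem: "x \<in> X ` space M" "y \<in> Y ` space M"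
      using z setsP by (auto simp: null_sets_def xy)
    have "emeasure ?P ({x} \<times> {y}) = emeasure (distr M ?S X) {x} * emeasure (distr M ?T Y) {y}"
      using mem by (intro DY.emeasure_pair_measure_Times) auto
    then have "emeasure (distr M ?S X) {x} = 0 \<or> emeasure (distr M ?T Y) {y} = 0"
      using z by (auto simp: null_sets_def xy)
    then have zero: "emeasure M (X -` {x} \<inter> space M) = 0 \<or> emeasure M (Y -` {y} \<inter> space M) = 0"
      using mem by (simp add: emeasure_distr)
    have mX: "X -` {x} \<inter> space M \<in> sets M" and mY: "Y -` {y} \<inter> space M \<in> sets M"
      using X Y by (auto intro: simple_functionD)
    let ?E = "(\<lambda>w. (X w, Y w)) -` {z} \<inter> space M"
    have "emeasure M ?E \<le> emeasure M (X -` {x} \<inter> space M)"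
      by (rule emeasure_mono[OF _ mX]) (auto simp: xy)
    moreover have "emeasure M ?E \<le> emeasure M (Y -` {y} \<inter> space M)"
      by (rule emeasure_mono[OF _ mY]) (auto simp: xy)
    ultimately have "emeasure M ?E = 0"
      using zero by auto
    then show ?thesis
      using mem by (simp add: null_sets_def emeasure_distr setsST xy)
  qed
  have "absolutely_continuous ?P ?Q"
    unfolding absolutely_continuous_def
  proof
    fix A assume A: "A \<in> null_sets ?P"
    then have sub: "A \<subseteq> X ` space M \<times> Y ` space M"
      using setsP by (auto simp: null_sets_def)
    have "{z} \<in> null_sets ?P" if "z \<in> A" for z
      using A that sub by (intro null_sets_subset[OF A]) (auto simp: setsP)
    then have "(\<Union>z\<in>A. {z}) \<in> null_sets ?Q"
      using fin finite_subset[OF sub]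
      by (intro null_sets_UN' null_point) (auto intro: countable_finite)
    then show "A \<in> null_sets ?Q" by simp
  qed
  moreover have "integrable ?Q (entropy_density b ?P ?Q)"
  proof (rule Q.integrable_const_bound)
    show "entropy_density b ?P ?Q \<in> borel_measurable ?Q"
      by (auto simp: measurable_def setsST spaceST)
    let ?f = "\<lambda>z. norm (entropy_density b ?P ?Q z)"
    show "AE z in ?Q. ?f z \<le> Max (?f ` (X ` space M \<times> Y ` space M))"
      using fin by (intro AE_I2 Max_ge) (auto simp: spaceST)
  qed
  moreover have "\<I>(X ; Y) = 0"
    using mutual_information_eq_entropy_conditional_entropy[OF X Y] eq by simp
  ultimately show ?thesis
    using mutual_information_indep_vars[of ?S X ?T Y] rvX rvY by blast
qed

section \<open>Arrays of all-or-nothing transforms\<close>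

lemma array_rep_in_PiE:
  assumes "\<phi> \<in> ({1..s} \<rightarrow>\<^sub>E \<Gamma>) \<rightarrow> ({1..s} \<rightarrow>\<^sub>E \<Gamma>)" "x \<in> {1..s} \<rightarrow>\<^sub>E \<Gamma>"
  shows "array_rep s \<phi> x \<in> {1..2 * s} \<rightarrow>\<^sub>E \<Gamma>"
proof (rule PiE_I)
  fix c assume c: "c \<in> {1..2 * s}"
  have \<phi>x: "\<phi> x \<in> {1..s} \<rightarrow>\<^sub>E \<Gamma>"
    by (rule funcset_mem[OF assms])
  show "array_rep s \<phi> x c \<in> \<Gamma>"
  proof (cases "c \<le> s")
    case True
    then have "x c \<in> \<Gamma>" using c by (intro PiE_mem[OF assms(2)]) simp
    then show ?thesis using c True by (simp add: array_rep_def)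
  next
    case False
    then have "c - s \<in> {1..s}" using c unfolding atLeastAtMost_iff by linarith
    then have "\<phi> x (c - s) \<in> \<Gamma>" by (rule PiE_mem[OF \<phi>x])
    then show ?thesis using c False by (simp add: array_rep_def)
  qed
qed (simp only: array_rep_def restrict_apply if_False)

text \<open>
  The array has \<open>(card \<Gamma>) ^ s\<close> rows, so unbiasedness on \<open>s\<close> columns means that every pattern on
  these columns is met exactly once.
\<close>

lemma unbiased_ex1_row:
  assumes "finite \<Gamma>" "\<Gamma> \<noteq> {}" and "unbiased \<Gamma> ({1..s} \<rightarrow>\<^sub>E \<Gamma>) A D"
    and "card D = s" and "u \<in> D \<rightarrow>\<^sub>E \<Gamma>"
  shows "\<exists>!x. x \<in> {1..s} \<rightarrow>\<^sub>E \<Gamma> \<and> restrict (A x) D = u"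
proof -
  have "card ({1..s} \<rightarrow>\<^sub>E \<Gamma>) = card \<Gamma> ^ s" by (simp add: card_PiE)
  moreover have "card \<Gamma> > 0" using assms(1,2) by (simp add: card_gt_0_iff)
  moreover have "real (card {x \<in> {1..s} \<rightarrow>\<^sub>E \<Gamma>. restrict (A x) D = u}) =
      real (card ({1..s} \<rightarrow>\<^sub>E \<Gamma>)) / real (card \<Gamma>) ^ card D"
    by (rule assms(3)[unfolded unbiased_def, THEN bspec, OF assms(5)])
  ultimately have "card {x \<in> {1..s} \<rightarrow>\<^sub>E \<Gamma>. restrict (A x) D = u} = 1"
    using assms(4) by simp
  then obtain x where "{x \<in> {1..s} \<rightarrow>\<^sub>E \<Gamma>. restrict (A x) D = u} = {x}"
    by (rule card_1_singletonE)
  then have "z \<in> {1..s} \<rightarrow>\<^sub>E \<Gamma> \<and> restrict (A z) D = u \<longleftrightarrow> z = x" for z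
    by (simp only: set_eq_iff mem_Collect_eq singleton_iff)
  then show ?thesis by (intro ex1I[of _ x]) simp_all
qed

lemma is_aontD:
  assumes "is_aont t s v \<Gamma> \<phi>"
  shows "finite \<Gamma>" "card \<Gamma> = v"
    and "\<phi> \<in> ({1..s} \<rightarrow>\<^sub>E \<Gamma>) \<rightarrow> ({1..s} \<rightarrow>\<^sub>E \<Gamma>)"
    and "unbiased \<Gamma> ({1..s} \<rightarrow>\<^sub>E \<Gamma>) (array_rep s \<phi>) {s+1..2 * s}"
    and "I \<subseteq> {1..s} \<Longrightarrow> card I = t \<Longrightarrow> J \<subseteq> {s+1..2 * s} \<Longrightarrow> card J = s - t \<Longrightarrow>
      unbiased \<Gamma> ({1..s} \<rightarrow>\<^sub>E \<Gamma>) (array_rep s \<phi>) (I \<union> J)"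
  using assms unfolding is_aont_def by iprover+

lemma aont_surj:
  assumes aont: "is_aont t s v \<Gamma> \<phi>" and "\<Gamma> \<noteq> {}" and y: "y \<in> {1..s} \<rightarrow>\<^sub>E \<Gamma>"
  shows "\<exists>x \<in> {1..s} \<rightarrow>\<^sub>E \<Gamma>. \<phi> x = y"
proof -
  let ?D = "{s+1..2 * s}"
  let ?u = "\<lambda>c\<in>?D. y (c - s)"
  have "?u \<in> ?D \<rightarrow>\<^sub>E \<Gamma>"
  proof (rule restrict_PiE_iff[THEN iffD2, rule_format])
    fix c assume "c \<in> ?D"
    then have "c - s \<in> {1..s}" unfolding atLeastAtMost_iff by linarith
    then show "y (c - s) \<in> \<Gamma>" by (rule PiE_mem[OF y])
  qed
  moreover have "card ?D = s" by simp
  ultimately have "\<exists>!x. x \<in> {1..s} \<rightarrow>\<^sub>E \<Gamma> \<and> restrict (array_rep s \<phi> x) ?D = ?u"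
    by (intro unbiased_ex1_row[OF is_aontD(1)[OF aont] assms(2) is_aontD(4)[OF aont]])
  then obtain x where x: "x \<in> {1..s} \<rightarrow>\<^sub>E \<Gamma>" and u: "restrict (array_rep s \<phi> x) ?D = ?u"
    by (elim ex1E conjE)
  have "\<phi> x = y"
  proof (rule PiE_ext[of _ "{1..s}" "\<lambda>_. \<Gamma>"])
    show "\<phi> x \<in> {1..s} \<rightarrow>\<^sub>E \<Gamma>" by (rule funcset_mem[OF is_aontD(3)[OF aont] x])
    fix j assume j: "j \<in> {1..s}"
    then have "j + s \<in> ?D" by simp
    then have "array_rep s \<phi> x (j + s) = y j"
      using fun_cong[OF u, of "j + s"] by (simp only: restrict_apply' add_diff_cancel_right')
    with j show "\<phi> x j = y j" by (simp add: array_rep_def)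
  qed (rule y)
  with x show ?thesis by blast
qed

text \<open>
  The columns of \<open>x\<^sub>I\<close> and \<open>\<phi>(x)\<^sub>J\<close> are \<open>t + (s - t) = s\<close> columns of the array, and a row is
  determined by its pattern on them.
\<close>

lemma aont_inputs_eq:
  assumes aont: "is_aont t s v \<Gamma> \<phi>" and ts: "t \<le> s"
    and I: "I \<subseteq> {1..s}" "card I = t" and J: "J \<subseteq> {1..s}" "card J = s - t"
    and x: "x \<in> {1..s} \<rightarrow>\<^sub>E \<Gamma>" and x': "x' \<in> {1..s} \<rightarrow>\<^sub>E \<Gamma>"
    and eqI: "restrict x I = restrict x' I" and eqJ: "restrict (\<phi> x) J = restrict (\<phi> x') J"
  shows "x = x'"
proof (cases "\<Gamma> = {}")
  case True
  then have "x 1 \<notin> \<Gamma>" by blast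
  then have "1 \<notin> {1..s}" using PiE_mem[OF x, of 1] by blast
  then have "{1..s} = {}" by simp
  then show ?thesis using x x' by (simp only: PiE_empty_domain singleton_iff)
next
  case False
  let ?J = "(\<lambda>j. s + j) ` J" and ?A = "array_rep s \<phi>"
  have J': "?J \<subseteq> {s+1..2 * s}" "card ?J = s - t"
    using J by (auto simp: card_image)
  have "I \<inter> ?J = {}" using I(1) J'(1) by fastforce
  moreover have "finite I" "finite ?J"
    using I J' by (auto intro: finite_subset)
  ultimately have card: "card (I \<union> ?J) = s"
    using I(2) J'(2) ts by (simp add: card_Un_disjoint)
  have row: "?A x \<in> {1..2 * s} \<rightarrow>\<^sub>E \<Gamma>"
    by (rule array_rep_in_PiE[OF is_aontD(3)[OF aont] x])
  have "I \<union> ?J \<subseteq> {1..2 * s}" using I(1) J'(1) by fastforce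
  then have u: "restrict (?A x) (I \<union> ?J) \<in> I \<union> ?J \<rightarrow>\<^sub>E \<Gamma>"
    by (intro restrict_PiE_iff[THEN iffD2] ballI PiE_mem[OF row]) (rule subsetD)
  have unb: "unbiased \<Gamma> ({1..s} \<rightarrow>\<^sub>E \<Gamma>) ?A (I \<union> ?J)"
    by (rule is_aontD(5)[OF aont I J'])
  have ex1: "\<exists>!z. z \<in> {1..s} \<rightarrow>\<^sub>E \<Gamma> \<and> restrict (?A z) (I \<union> ?J) = restrict (?A x) (I \<union> ?J)"
    by (rule unbiased_ex1_row[OF is_aontD(1)[OF aont] False unb card u])
  have "restrict (?A x') (I \<union> ?J) = restrict (?A x) (I \<union> ?J)"
  proof (rule restrict_ext)
    fix c assume "c \<in> I \<union> ?J"
    then show "?A x' c = ?A x c"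
    proof
      assume "c \<in> I"
      then show ?thesis using I(1) fun_cong[OF eqI, of c] by (auto simp: array_rep_def)
    next
      assume "c \<in> ?J"
      then obtain j where "j \<in> J" "c = s + j" by blast
      then show ?thesis using J(1) fun_cong[OF eqJ, of j] by (auto simp: array_rep_def)
    qed
  qed
  with ex1 x x' show ?thesis by blast
qed

section \<open>Functions that ignore every coordinate\<close>

lemma PiE_constant_if_ignores_each_coordinate:
  assumes fin: "finite S"
    and ignores: "\<And>i. i \<in> S \<Longrightarrow> \<exists>I. i \<notin> I \<and>
        (\<forall>x \<in> S \<rightarrow>\<^sub>E \<Gamma>. \<forall>y \<in> S \<rightarrow>\<^sub>E \<Gamma>. restrict x I = restrict y I \<longrightarrow> f x = f y)"
    and x: "x \<in> S \<rightarrow>\<^sub>E \<Gamma>" and y: "y \<in> S \<rightarrow>\<^sub>E \<Gamma>"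
  shows "f x = f y"
proof -
  \<comment> \<open>Turn \<open>x\<close> into \<open>y\<close> one coordinate at a time; \<open>D\<close> contains the coordinates still to be changed.\<close>
  have "f x = f y" if "D \<subseteq> S" "x \<in> S \<rightarrow>\<^sub>E \<Gamma>" "\<forall>i \<in> S - D. x i = y i" for D x
    using finite_subset[OF that(1) fin] that
  proof (induction D arbitrary: x rule: finite_induct)
    case empty
    then have "x = y" using y by (intro PiE_ext[of x S _ y]) auto
    then show ?case by simp
  next
    case (insert i D)
    then have i: "i \<in> S" by simp
    let ?z = "x(i := y i)"
    have z: "?z \<in> S \<rightarrow>\<^sub>E \<Gamma>"
      using insert.prems(2) y i by (auto simp: PiE_def extensional_def)
    obtain I where I: "i \<notin> I"
      "\<forall>x \<in> S \<rightarrow>\<^sub>E \<Gamma>. \<forall>y \<in> S \<rightarrow>\<^sub>E \<Gamma>. restrict x I = restrict y I \<longrightarrow> f x = f y"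
      using ignores[OF i] by blast
    have "restrict x I = restrict ?z I" using I(1) by (auto simp: restrict_def)
    then have "f x = f ?z" using I(2) insert.prems(2) z by blast
    also have "f ?z = f y"
      using insert.prems z by (intro insert.IH) auto
    finally show ?case .
  qed
  from this[of S x] x show ?thesis by simp
qed

text \<open>
  A quantity that can be read off from every choice of \<open>k\<close> coordinates, \<open>k < card S\<close>, is constant:
  each coordinate is missed by one of these choices.
\<close>

lemma constant_if_read_from_every_subset:
  assumes fin: "finite S" and k: "k < card S"
    and read: "\<And>I x. I \<subseteq> S \<Longrightarrow> card I = k \<Longrightarrow> x \<in> S \<rightarrow>\<^sub>E \<Gamma> \<Longrightarrow> f x = a I (restrict x I)"
    and xy: "x \<in> S \<rightarrow>\<^sub>E \<Gamma>" "y \<in> S \<rightarrow>\<^sub>E \<Gamma>"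
  shows "f x = f y"
proof (rule PiE_constant_if_ignores_each_coordinate[OF fin _ xy])
  fix i assume "i \<in> S"
  then have "k \<le> card (S - {i})" using k fin by simp
  then obtain I where "I \<subseteq> S - {i}" and k': "card I = k"
    by (meson obtain_subset_with_card_n)
  then have "i \<notin> I" "I \<subseteq> S" by blast+
  then show "\<exists>I. i \<notin> I \<and>
      (\<forall>x \<in> S \<rightarrow>\<^sub>E \<Gamma>. \<forall>y \<in> S \<rightarrow>\<^sub>E \<Gamma>. restrict x I = restrict y I \<longrightarrow> f x = f y)"
    using read[OF _ k'] by (intro exI[of _ I] conjI ballI impI) simp_all
qed

text \<open>
  All the factorisations of the same positive \<open>p\<close> share their factors: fixing \<open>J\<close> shows that the
  left factor does not depend on \<open>I\<close>, and fixing \<open>I\<close> that the right one does not depend on \<open>J\<close>.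
\<close>

lemma product_of_marginals_constant:
  fixes p :: "(nat \<Rightarrow> 'a) \<Rightarrow> real"
  assumes fin: "finite S" and t: "0 < t" "t < card S"
    and maps: "\<phi> \<in> (S \<rightarrow>\<^sub>E \<Gamma>) \<rightarrow> (S \<rightarrow>\<^sub>E \<Gamma>)"
    and surj: "\<And>y. y \<in> S \<rightarrow>\<^sub>E \<Gamma> \<Longrightarrow> \<exists>x \<in> S \<rightarrow>\<^sub>E \<Gamma>. \<phi> x = y"
    and pos: "\<And>x. x \<in> S \<rightarrow>\<^sub>E \<Gamma> \<Longrightarrow> p x > 0"
    and factor: "\<And>I J x. I \<subseteq> S \<Longrightarrow> card I = t \<Longrightarrow> J \<subseteq> S \<Longrightarrow> card J = card S - t \<Longrightarrow>
        x \<in> S \<rightarrow>\<^sub>E \<Gamma> \<Longrightarrow> p x = a I (restrict x I) * c J (restrict (\<phi> x) J)"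
    and xy: "x \<in> S \<rightarrow>\<^sub>E \<Gamma>" "y \<in> S \<rightarrow>\<^sub>E \<Gamma>"
  shows "p x = p y"
proof -
  obtain I0 where I0: "I0 \<subseteq> S" "card I0 = t"
    using t by (meson obtain_subset_with_card_n less_imp_le)
  obtain J0 where J0: "J0 \<subseteq> S" "card J0 = card S - t"
    by (meson obtain_subset_with_card_n diff_le_self)
  have left: "a I0 (restrict x I0) = a I (restrict x I)"
    if "I \<subseteq> S" "card I = t" "x \<in> S \<rightarrow>\<^sub>E \<Gamma>" for I x
    using factor[OF I0 J0 that(3)] factor[OF that(1,2) J0 that(3)] pos[OF that(3)] by auto
  have right: "c J0 (restrict z J0) = c J (restrict z J)"
    if J: "J \<subseteq> S" "card J = card S - t" and z: "z \<in> S \<rightarrow>\<^sub>E \<Gamma>" for J z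
  proof -
    obtain w where w: "w \<in> S \<rightarrow>\<^sub>E \<Gamma>" "\<phi> w = z" using surj[OF z] by blast
    show ?thesis
      using factor[OF I0 J0 w(1)] factor[OF I0 J w(1)] pos[OF w(1)] w(2) by auto
  qed
  have "a I0 (restrict x I0) = a I0 (restrict y I0)"
    using left by (rule constant_if_read_from_every_subset[OF fin t(2) _ xy])
  moreover have "c J0 (restrict (\<phi> x) J0) = c J0 (restrict (\<phi> y) J0)"
    using t right maps xy
    by (intro constant_if_read_from_every_subset[of S "card S - t" \<Gamma>
          "\<lambda>z. c J0 (restrict z J0)" c]) (auto simp: fin)
  ultimately show ?thesis
    using factor[OF I0 J0 xy(1)] factor[OF I0 J0 xy(2)] by simp
qed

section \<open>Perfect security forces the uniform distribution\<close>

lemma (in information_space) perfectly_secure_prob_eq_product: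
  assumes ts: "t \<le> s" and aont: "is_aont t s v \<Gamma> \<phi>"
    and X: "X \<in> M \<rightarrow>\<^sub>M count_space ({1..s} \<rightarrow>\<^sub>E \<Gamma>)"
    and sec: "perfect_security t s \<phi> X"
    and I: "I \<subseteq> {1..s}" "card I = t" and J: "J \<subseteq> {1..s}" "card J = s - t"
    and x: "x \<in> {1..s} \<rightarrow>\<^sub>E \<Gamma>" and pos: "prob {\<omega> \<in> space M. X \<omega> = x} > 0"
  shows "prob {\<omega> \<in> space M. X \<omega> = x} =
    prob {\<omega> \<in> space M. restrict (X \<omega>) I = restrict x I} *
    prob {\<omega> \<in> space M. restrict (\<phi> (X \<omega>)) J = restrict (\<phi> x) J}"
proof -
  let ?XI = "\<lambda>\<omega>. restrict (X \<omega>) I" and ?YJ = "\<lambda>\<omega>. restrict (\<phi> (X \<omega>)) J"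
  have range: "X \<omega> \<in> {1..s} \<rightarrow>\<^sub>E \<Gamma>" if "\<omega> \<in> space M" for \<omega>
    using measurable_space[OF X that] by simp
  have "finite ({1..s} \<rightarrow>\<^sub>E \<Gamma>)"
    using is_aontD(1)[OF aont] by (intro finite_PiE) auto
  then have "simple_function M X"
    using range X by (auto simp: simple_function_def intro!: measurable_sets[OF X] intro: finite_subset)
  then have simple: "simple_function M (\<lambda>\<omega>. g (X \<omega>))" for g :: "(nat \<Rightarrow> 'b) \<Rightarrow> (nat \<Rightarrow> 'b)"
    by (rule simple_function_compose1)
  have XI: "simple_function M ?XI" and YJ: "simple_function M ?YJ"
    by (rule simple)+
  have "\<H>(?XI | ?YJ) = \<H>(?XI)"
    using sec I J unfolding perfect_security_def by blast
  from indep_var_of_conditional_entropy_eq[OF XI YJ this]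
  have indep: "indep_var (count_space (?XI ` space M)) ?XI (count_space (?YJ ` space M)) ?YJ" .
  have "{\<omega> \<in> space M. X \<omega> = x} \<noteq> {}" using pos by (auto simp del: Collect_empty_eq)
  then obtain \<omega>0 where w0: "\<omega>0 \<in> space M" "X \<omega>0 = x" by blast
  have "{\<omega> \<in> space M. X \<omega> = x} =
      (\<lambda>\<omega>. (?XI \<omega>, ?YJ \<omega>)) -` ({restrict x I} \<times> {restrict (\<phi> x) J}) \<inter> space M"
    using aont_inputs_eq[OF aont ts I J range x] by auto
  also have "prob \<dots> = prob (?XI -` {restrict x I} \<inter> space M) *
      prob (?YJ -` {restrict (\<phi> x) J} \<inter> space M)"
    using w0 by (intro indep_varD[OF indep]) auto
  also have "?XI -` {restrict x I} \<inter> space M = {\<omega> \<in> space M. ?XI \<omega> = restrict x I}"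
    by blast
  also have "?YJ -` {restrict (\<phi> x) J} \<inter> space M = {\<omega> \<in> space M. ?YJ \<omega> = restrict (\<phi> x) J}"
    by blast
  finally show ?thesis .
qed

theorem theorem2p10:
  fixes t s v :: nat
    and \<Gamma> :: "'a set"
    and \<phi> :: "(nat \<Rightarrow> 'a) \<Rightarrow> (nat \<Rightarrow> 'a)"
    and M :: "'w measure"
    and X :: "'w \<Rightarrow> nat \<Rightarrow> 'a"
    and b :: real
  assumes "1 \<le> t" and "t < s"
    and "is_aont t s v \<Gamma> \<phi>"
    and "information_space M b"
    and "X \<in> M \<rightarrow>\<^sub>M count_space ({1..s} \<rightarrow>\<^sub>E \<Gamma>)"
    and "\<forall>x \<in> {1..s} \<rightarrow>\<^sub>E \<Gamma>. measure M {\<omega> \<in> space M. X \<omega> = x} > 0"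
    and "information_space.perfect_security M b t s \<phi> X"
  shows "\<forall>x \<in> {1..s} \<rightarrow>\<^sub>E \<Gamma>. measure M {\<omega> \<in> space M. X \<omega> = x} = 1 / real v ^ s"
proof
  interpret information_space M b by fact
  let ?R = "{1..s} \<rightarrow>\<^sub>E \<Gamma>"
  let ?p = "\<lambda>x. prob {\<omega> \<in> space M. X \<omega> = x}"
  fix x assume x: "x \<in> ?R"
  have \<Gamma>: "finite \<Gamma>" "card \<Gamma> = v" and maps: "\<phi> \<in> ?R \<rightarrow> ?R"
    using is_aontD(1-3)[OF assms(3)] .
  have "x 1 \<in> \<Gamma>" using PiE_mem[OF x, of 1] assms(1,2) by simp
  then have nonempty: "\<Gamma> \<noteq> {}" by blast
  have const: "?p z = ?p x" if z: "z \<in> ?R" for z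
  proof (rule product_of_marginals_constant[of "{1..s}" t \<phi> \<Gamma>])
    show "?p x = prob {\<omega> \<in> space M. restrict (X \<omega>) I = restrict x I} *
        prob {\<omega> \<in> space M. restrict (\<phi> (X \<omega>)) J = restrict (\<phi> x) J}"
      if "I \<subseteq> {1..s}" "card I = t" "J \<subseteq> {1..s}" "card J = card {1..s} - t" "x \<in> ?R" for I J x
      using perfectly_secure_prob_eq_product[OF _ assms(3,5,7)] that assms(2,6) by simp
  qed (use assms maps aont_surj[OF assms(3) nonempty] x z in auto)
  have finR: "finite ?R" using \<Gamma> by (intro finite_PiE) auto
  have meas: "{\<omega> \<in> space M. X \<omega> = z} \<in> sets M" if "z \<in> ?R" for z
    using measurable_sets[OF assms(5), of "{z}"] that by (simp add: vimage_def Int_def conj_commute)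
  have "(\<Sum>z\<in>?R. ?p z) = prob (\<Union>z\<in>?R. {\<omega> \<in> space M. X \<omega> = z})"
    using finR meas by (intro finite_measure_finite_Union[symmetric]) (auto simp: disjoint_family_on_def)
  also have "(\<Union>z\<in>?R. {\<omega> \<in> space M. X \<omega> = z}) = space M"
    using measurable_space[OF assms(5)] by auto
  finally have "(\<Sum>z\<in>?R. ?p z) = 1" by (simp add: prob_space)
  moreover have "(\<Sum>z\<in>?R. ?p z) = real (card ?R) * ?p x"
    using const by simp
  moreover have "card ?R = v ^ s" using \<Gamma> by (simp add: card_PiE)
  ultimately have "real v ^ s * ?p x = 1" by simp
  then show "?p x = 1 / real v ^ s"
    by (metis mult_zero_left nonzero_mult_div_cancel_left zero_neq_one)
qed

end
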